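(* (Overestimation of free energy differences with imperfect bare measurements.) Let $\beta>0$. Let $\boldsymbol\gamma$ be a random variable (the microscopic trajectory) and $\mathbf r_n$ a random variable with finitely many values (the measurement record) on a common probability space, let $W(\boldsymbol\gamma)$ be a real-valued integrable function of $\boldsymbol\gamma$ (the perfectly measured work) with $\langle e^{-\beta W(\boldsymbol\gamma)}\rangle_{\boldsymbol\gamma}<\infty$, and let the observed work be $$W(\mathbf r_n)=\sum_{\boldsymbol\gamma}W(\boldsymbol\gamma)P(\boldsymbol\gamma|\mathbf r_n).$$ Then $$\left\langle e^{-\beta W(\mathbf r_n)}\right\rangle_{\mathbf r_n}\le\left\langle e^{-\beta W(\boldsymbol\gamma)}\right\rangle_{\boldsymbol\gamma}.$$ Equivalently, if $\Delta F_{\mathrm{est}}$ and $\Delta F$ are the real numbers determined by $\langle e^{-\beta W(\mathbf r_n)}\rangle_{\mathbf r_n}=e^{-\beta\Delta F_{\mathrm{est}}}$ and $\langle e^{-\beta W(\boldsymbol\gamma)}\rangle_{\boldsymbol\gamma}=e^{-\beta\Delta F}$, then $$\Delta F_{\mathrm{est}}\ge\Delta F.$$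
   Context: $P(\boldsymbol\gamma|\mathbf r_n)$ is the conditional probability distribution of the trajectory $\boldsymbol\gamma$ given the record $\mathbf r_n$ (defined for records of positive probability), and $\sum_{\boldsymbol\gamma}$ denotes summation (or integration) over trajectories, so $W(\mathbf r_n)$ is the conditional expectation of $W(\boldsymbol\gamma)$ given $\mathbf r_n$. $\langle\cdot\rangle_{\boldsymbol\gamma}$ and $\langle\cdot\rangle_{\mathbf r_n}$ denote expectations over the distributions of $\boldsymbol\gamma$ and $\mathbf r_n$, e.g. $\langle g(\mathbf r_n)\rangle_{\mathbf r_n}=\sum_{\mathbf r_n}P(\mathbf r_n)g(\mathbf r_n)$. Physically, $\beta$ is the inverse temperature, $\Delta F$ is the true free energy difference (the second defining relation being the Jarzynski equality for the perfectly and continuously measured system), and $\Delta F_{\mathrm{est}}$ is the free energy difference estimated from the observed work statistics. *)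

theory Defs
  imports "HOL-Probability.Probability"
begin

definition record_prob :: "'w measure \<Rightarrow> ('w \<Rightarrow> 'r) \<Rightarrow> 'r \<Rightarrow> real" where
  "record_prob M r \<rho> = measure M (r -` {\<rho>} \<inter> space M)"

definition record_expectation :: "'w measure \<Rightarrow> ('w \<Rightarrow> 'r) \<Rightarrow> ('r \<Rightarrow> real) \<Rightarrow> real" where
  "record_expectation M r g = (\<Sum>\<rho>\<in>r ` space M. record_prob M r \<rho> * g \<rho>)"

definition trajectory_expectation ::
    "'w measure \<Rightarrow> 'g measure \<Rightarrow> ('w \<Rightarrow> 'g) \<Rightarrow> ('g \<Rightarrow> real) \<Rightarrow> real" where
  "trajectory_expectation M N \<gamma> f = (\<integral>x. f x \<partial>distr M N \<gamma>)"

(* The law of the trajectory under M conditioned on the event r = \<rho>. If that event has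
   probability zero the result is a junk value, which carries weight zero in
   record_expectation. *)
definition conditional_trajectory_law ::
    "'w measure \<Rightarrow> 'g measure \<Rightarrow> ('w \<Rightarrow> 'g) \<Rightarrow> ('w \<Rightarrow> 'r) \<Rightarrow> 'r \<Rightarrow> 'g measure" where
  "conditional_trajectory_law M N \<gamma> r \<rho> =
     distr (uniform_measure M (r -` {\<rho>} \<inter> space M)) N \<gamma>"

definition observed_work ::
    "'w measure \<Rightarrow> 'g measure \<Rightarrow> ('w \<Rightarrow> 'g) \<Rightarrow> ('w \<Rightarrow> 'r) \<Rightarrow> ('g \<Rightarrow> real) \<Rightarrow> 'r \<Rightarrow> real" where
  "observed_work M N \<gamma> r W \<rho> = (\<integral>x. W x \<partial>conditional_trajectory_law M N \<gamma> r \<rho>)"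

end

theory Submission
  imports Defs
begin

text \<open>The values of the record partition the probability space into finitely many cells. On each cell
of positive probability, Jensen's inequality for the convex function \<open>x \<mapsto> exp (- \<beta> * x)\<close> under the
conditional measure bounds the term of the observed work by the integral of the true exponential
over that cell; summing over the cells gives the inequality of expectations.\<close>

text \<open>Conditioning on \<open>A\<close> amounts to the bounded density
  \<open>indicator A x / measure M A\<close> relative to \<open>M\<close>. Integrability therefore
  carries over, and conditional means become normalised set integrals.\<close>

lemma (in finite_measure)
  fixes f :: "'a \<Rightarrow> real"
  assumes A: "A \<in> sets M" "measure M A > 0" and f: "integrable M f"
  shows integrable_uniform_measure: "integrable (uniform_measure M A) f"
    and integral_uniform_measure:
      "(\<integral>x. f x \<partial>uniform_measure M A) = (\<integral>x\<in>A. f x \<partial>M) / measure M A"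
proof -
  \<comment> \<open>The quotient of extended reals in \<open>uniform_measure_def\<close> is recast
    as \<open>ennreal\<close> of a real quotient, the form that the real density rules
    expect.\<close>
  have dens: "uniform_measure M A = density M (\<lambda>x. ennreal (indicator A x / measure M A))"
    unfolding uniform_measure_def
    using A by (intro arg_cong[where f = "density M"] ext)
      (auto simp: emeasure_eq_measure divide_ennreal[symmetric] split: split_indicator)
  have "integrable M (\<lambda>x. (indicator A x * f x) / measure M A)"
    using A f integrable_real_mult_indicator[OF A(1) f] by (simp add: mult.commute)
  then show "integrable (uniform_measure M A) f"
    unfolding dens using A f by (subst integrable_real_density) auto
  have "(\<integral>x. f x \<partial>uniform_measure M A) = (\<integral>x. (indicator A x * f x) / measure M A \<partial>M)"
    unfolding dens using A f by (subst integral_real_density) auto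
  then show "(\<integral>x. f x \<partial>uniform_measure M A) = (\<integral>x\<in>A. f x \<partial>M) / measure M A"
    by (simp add: set_lebesgue_integral_def)
qed

text \<open>Simplicity of \<open>r\<close> supplies finitely many measurable cells, so sum and
  integral may be exchanged. The cells are disjoint and cover the space, so their indicators add up
  to 1 at every point.\<close>

lemma sum_set_integral_simple_function:
  fixes f :: "'w \<Rightarrow> real"
  assumes r: "simple_function M r" and f: "integrable M f"
  shows "(\<Sum>\<rho>\<in>r ` space M. \<integral>\<omega>\<in>r -` {\<rho>} \<inter> space M. f \<omega> \<partial>M) = (\<integral>\<omega>. f \<omega> \<partial>M)"
proof -
  note fin = simple_functionD(1)[OF r] and cell = simple_functionD(2)[OF r]
  have "(\<Sum>\<rho>\<in>r ` space M. \<integral>\<omega>\<in>r -` {\<rho>} \<inter> space M. f \<omega> \<partial>M)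
      = (\<integral>\<omega>. (\<Sum>\<rho>\<in>r ` space M. indicator (r -` {\<rho>} \<inter> space M) \<omega> * f \<omega>) \<partial>M)"
    unfolding set_lebesgue_integral_def real_scaleR_def
    using integrable_real_mult_indicator[OF cell f]
    by (subst Bochner_Integration.integral_sum) (auto simp: mult.commute)
  also have "\<dots> = (\<integral>\<omega>. f \<omega> \<partial>M)"
  proof (rule Bochner_Integration.integral_cong[OF refl])
    fix \<omega> assume \<omega>: "\<omega> \<in> space M"
    have "(\<Sum>\<rho>\<in>r ` space M. indicator (r -` {\<rho>} \<inter> space M) \<omega> * f \<omega>)
        = (\<Sum>\<rho>\<in>r ` space M. if \<rho> = r \<omega> then f \<omega> else 0)"
      using \<omega> by (intro sum.cong) auto
    then show "(\<Sum>\<rho>\<in>r ` space M. indicator (r -` {\<rho>} \<inter> space M) \<omega> * f \<omega>) = f \<omega>"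
      using \<omega> fin by simp
  qed
  finally show ?thesis .
qed

lemma (in prob_space) sum_record_prob:
  assumes "simple_function M r"
  shows "(\<Sum>\<rho>\<in>r ` space M. record_prob M r \<rho>) = 1"
  using sum_set_integral_simple_function[OF assms, of "\<lambda>_. 1"] simple_functionD(2)[OF assms]
  by (simp add: record_prob_def set_lebesgue_integral_def prob_space)

text \<open>This makes the logarithm behind \<open>\<Delta>F_est\<close> available. The weights sum
  to 1, so at least one record has positive weight and contributes a positive term.\<close>

lemma (in prob_space) record_expectation_pos:
  assumes r: "simple_function M r" and g: "\<And>\<rho>. g \<rho> > 0"
  shows "record_expectation M r g > 0"
proof -
  have nonneg: "record_prob M r \<rho> \<ge> 0" for \<rho>
    by (simp add: record_prob_def)
  obtain \<rho> where \<rho>: "\<rho> \<in> r ` space M" "record_prob M r \<rho> \<noteq> 0"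
    using sum_record_prob[OF r] by (metis sum.neutral zero_neq_one)
  then have "record_prob M r \<rho> * g \<rho> > 0"
    using nonneg[of \<rho>] g[of \<rho>] by simp
  then show ?thesis
    unfolding record_expectation_def
    using \<rho> nonneg g simple_functionD(1)[OF r] by (intro sum_pos2[of _ \<rho>]) (auto simp: less_imp_le)
qed

text \<open>The exponential matters only through its convexity, so the bound is stated for any
  convex \<open>q\<close>. It is the conditional Jensen inequality combined with the tower property
  over a finite partition.\<close>

lemma (in prob_space) record_expectation_observed_work_le:
  fixes W :: "'g \<Rightarrow> real" and q :: "real \<Rightarrow> real"
  assumes \<gamma>: "\<gamma> \<in> measurable M N" and r: "simple_function M r"
    and W: "integrable (distr M N \<gamma>) W" and qW: "integrable (distr M N \<gamma>) (\<lambda>x. q (W x))"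
    and q: "convex_on UNIV q"
  shows "record_expectation M r (\<lambda>\<rho>. q (observed_work M N \<gamma> r W \<rho>))
      \<le> trajectory_expectation M N \<gamma> (\<lambda>x. q (W x))"
proof -
  have W_meas: "W \<in> borel_measurable N" and qW_meas: "(\<lambda>x. q (W x)) \<in> borel_measurable N"
    using W qW by (auto dest!: borel_measurable_integrable)
  have int: "integrable M (\<lambda>\<omega>. W (\<gamma> \<omega>))" and qint: "integrable M (\<lambda>\<omega>. q (W (\<gamma> \<omega>)))"
    using W qW W_meas qW_meas \<gamma> by (auto simp: integrable_distr_eq)
  have "record_prob M r \<rho> * q (observed_work M N \<gamma> r W \<rho>)
      \<le> (\<integral>\<omega>\<in>r -` {\<rho>} \<inter> space M. q (W (\<gamma> \<omega>)) \<partial>M)" for \<rho>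
  proof -
    define A where "A = r -` {\<rho>} \<inter> space M"
    have A: "A \<in> sets M"
      unfolding A_def using simple_functionD(2)[OF r] .
    \<comment> \<open>Change of variables from trajectories back to the sample space; it needs only
      measurability, so it covers null cells too.\<close>
    have law: "observed_work M N \<gamma> r W \<rho> = (\<integral>\<omega>. W (\<gamma> \<omega>) \<partial>uniform_measure M A)"
      unfolding observed_work_def conditional_trajectory_law_def A_def
      using \<gamma> W_meas by (subst integral_distr) (auto cong: measurable_cong_sets)
    show ?thesis
    proof (cases "measure M A = 0")
      \<comment> \<open>On a null cell \<open>observed_work\<close> is a junk value, but its weight
        is 0. Since \<open>q\<close> may be negative, the integral on the right must be shown to
        vanish as well.\<close>
      case True
      then have "AE \<omega> in M. \<omega> \<notin> A"
        using A by (intro AE_not_in) (simp add: null_sets_def emeasure_eq_measure)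
      then have "(\<integral>\<omega>\<in>A. q (W (\<gamma> \<omega>)) \<partial>M) = 0"
        unfolding set_lebesgue_integral_def by (intro integral_eq_zero_AE) auto
      then show ?thesis
        using True by (simp add: record_prob_def A_def)
    next
      case False
      then have pos: "measure M A > 0"
        by (simp add: zero_less_measure_iff)
      interpret U: prob_space "uniform_measure M A"
        using pos by (intro prob_space_uniform_measure) (auto simp: emeasure_eq_measure)
      have "q (\<integral>\<omega>. W (\<gamma> \<omega>) \<partial>uniform_measure M A)
          \<le> (\<integral>\<omega>. q (W (\<gamma> \<omega>)) \<partial>uniform_measure M A)"
        by (rule U.jensens_inequality[where I = UNIV])
          (use q integrable_uniform_measure[OF A pos] int qint in auto)
      \<comment> \<open>Multiplying Jensen's inequality by \<open>measure M A\<close> cancels the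
        normalisation of the conditional mean.\<close>
      then show ?thesis
        unfolding integral_uniform_measure[OF A pos qint] law
        using pos by (simp add: record_prob_def A_def field_simps)
    qed
  qed
  then have "record_expectation M r (\<lambda>\<rho>. q (observed_work M N \<gamma> r W \<rho>))
      \<le> (\<Sum>\<rho>\<in>r ` space M. \<integral>\<omega>\<in>r -` {\<rho>} \<inter> space M. q (W (\<gamma> \<omega>)) \<partial>M)"
    unfolding record_expectation_def by (rule sum_mono)
  also have "\<dots> = trajectory_expectation M N \<gamma> (\<lambda>x. q (W x))"
    unfolding trajectory_expectation_def
    using sum_set_integral_simple_function[OF r qint] \<gamma> qW_meas by (simp add: integral_distr)
  finally show ?thesis .
qed

lemma ex1_exp_neg_mult:
  fixes \<beta> x :: real
  assumes "\<beta> \<noteq> 0" "x > 0"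
  shows "\<exists>!y. x = exp (- \<beta> * y)"
proof (rule ex1I[of _ "- ln x / \<beta>"])
  show "x = exp (- \<beta> * (- ln x / \<beta>))"
    using assms by simp
  show "y = - ln x / \<beta>" if "x = exp (- \<beta> * y)" for y
    using assms that by simp
qed

theorem mainTheorem3:
  fixes M :: "'w measure" and N :: "'g measure"
    and \<gamma> :: "'w \<Rightarrow> 'g" and r :: "'w \<Rightarrow> 'r"
    and W :: "'g \<Rightarrow> real" and \<beta> :: real
  assumes "\<beta> > 0"
    and "prob_space M"
    and "\<gamma> \<in> measurable M N"
    and "simple_function M r"
    and "integrable (distr M N \<gamma>) W"
    and "integrable (distr M N \<gamma>) (\<lambda>x. exp (- \<beta> * W x))"
  shows "record_expectation M r (\<lambda>\<rho>. exp (- \<beta> * observed_work M N \<gamma> r W \<rho>))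
           \<le> trajectory_expectation M N \<gamma> (\<lambda>x. exp (- \<beta> * W x))
    \<and> (\<exists>!\<Delta>F_est. record_expectation M r (\<lambda>\<rho>. exp (- \<beta> * observed_work M N \<gamma> r W \<rho>))
           = exp (- \<beta> * \<Delta>F_est))
    \<and> (\<exists>!\<Delta>F. trajectory_expectation M N \<gamma> (\<lambda>x. exp (- \<beta> * W x)) = exp (- \<beta> * \<Delta>F))
    \<and> (\<forall>\<Delta>F_est \<Delta>F.
           record_expectation M r (\<lambda>\<rho>. exp (- \<beta> * observed_work M N \<gamma> r W \<rho>))
             = exp (- \<beta> * \<Delta>F_est)
           \<longrightarrow> trajectory_expectation M N \<gamma> (\<lambda>x. exp (- \<beta> * W x)) = exp (- \<beta> * \<Delta>F)
           \<longrightarrow> \<Delta>F_est \<ge> \<Delta>F)"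
proof -
  interpret prob_space M by fact
  let ?R = "record_expectation M r (\<lambda>\<rho>. exp (- \<beta> * observed_work M N \<gamma> r W \<rho>))"
  let ?T = "trajectory_expectation M N \<gamma> (\<lambda>x. exp (- \<beta> * W x))"
  have convex: "convex_on UNIV (\<lambda>x. exp (- \<beta> * x))"
    \<comment> \<open>Convexity from a nondecreasing derivative.\<close>
    by (rule convex_on_realI[where f' = "\<lambda>x. - \<beta> * exp (- \<beta> * x)"])
      (use assms(1) in \<open>auto intro!: derivative_eq_intros\<close>)
  have le: "?R \<le> ?T"
    using record_expectation_observed_work_le[OF assms(3-6) convex] .
  have R: "?R > 0"
    using assms(4) by (rule record_expectation_pos) simp
  \<comment> \<open>For positive \<open>\<beta>\<close> the map
    \<open>x \<mapsto> exp (- \<beta> * x)\<close> is strictly decreasing, so the order of the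
    exponents is reversed.\<close>
  have "\<Delta>F_est \<ge> \<Delta>F" if "?R = exp (- \<beta> * \<Delta>F_est)" "?T = exp (- \<beta> * \<Delta>F)" for \<Delta>F_est \<Delta>F
    using le assms(1) unfolding that by simp
  \<comment> \<open>Positivity of \<open>?T\<close> is inherited from \<open>?R\<close> through
    \<open>le\<close>.\<close>
  moreover have "\<beta> \<noteq> 0" "?T > 0"
    using assms(1) R le by auto
  ultimately show ?thesis
    using le R ex1_exp_neg_mult by blast
qed

end
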